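(* Let $P$ and $Q$ be non-negative integers with binary digits $P=a_{n+1}a_n\cdots a_1$ and $Q=b_{n+1}b_n\cdots b_1$ ($a_1,b_1$ least significant; digits beyond these are taken to be $0$), and suppose $(P,Q)$ is a non-leaf node, i.e. there exists at least one pair $(X,Y)$ of non-negative integers with $\mathrm{CVT}(X,Y)=P$ and $\mathrm{XOR}(X,Y)=Q$. Let $m$ be the number of indices $i$ with $1\le i\le n+1$ such that $a_{i+1}=0$ and $b_i=1$. Then the number of pairs $(X,Y)$ of non-negative integers with $\mathrm{CVT}(X,Y)=P$ and $\mathrm{XOR}(X,Y)=Q$ is exactly $2^m$. These pairs are obtained by choosing, at each of these $m$ bit positions $i$, the bits $(x_i,y_i)$ of $(X,Y)$ to be either $(0,1)$ or $(1,0)$, while the bits at the other positions are fixed.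
   Context: For non-negative integers $X,Y$ written in binary, $\mathrm{XOR}(X,Y)$ is their bitwise exclusive or, and $\mathrm{CVT}(X,Y)=2\cdot(X \mathbin{\mathrm{AND}} Y)$ (bitwise AND shifted one position left, so bit $i+1$ of $\mathrm{CVT}(X,Y)$ is $x_i \mathbin{\mathrm{AND}} y_i$, where $x_i,y_i$ are bit $i$ of $X,Y$, and bit $1$ of $\mathrm{CVT}(X,Y)$ is $0$). In the CVT-XOR Tree with root $(0,N)$, nodes are pairs $(X,Y)$ of non-negative integers with $X+Y=N$, and the successors (children) of a node $(P,Q)$ are the pairs $(X,Y)$ with $(\mathrm{CVT}(X,Y),\mathrm{XOR}(X,Y))=(P,Q)$; a node is non-leaf if it has at least one such successor. *)

theory Defs
  imports Main
begin

text \<open>Binary digits are numbered from 1 (least significant), whereas the library's \<^const>\<open>bit\<close>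
  numbers them from 0; \<open>digit N i\<close> is only meaningful for \<open>i \<ge> 1\<close>.\<close>

definition digit :: "nat \<Rightarrow> nat \<Rightarrow> nat" where
  "digit N i = of_bool (bit N (i - 1))"

definition XOR :: "nat \<Rightarrow> nat \<Rightarrow> nat" where
  "XOR X Y = Bit_Operations.xor X Y"

definition CVT :: "nat \<Rightarrow> nat \<Rightarrow> nat" where
  "CVT X Y = 2 * Bit_Operations.and X Y"

text \<open>Since \<open>X + Y = CVT X Y + XOR X Y\<close>, the children of a node with coordinate sum \<open>N\<close>
  again have coordinate sum \<open>N\<close>, so the root \<open>(0, N)\<close> need not be a parameter.\<close>

definition children :: "nat \<times> nat \<Rightarrow> (nat \<times> nat) set" where
  "children v = {(X, Y). (CVT X Y, XOR X Y) = v}"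

definition non_leaf :: "nat \<times> nat \<Rightarrow> bool" where
  "non_leaf v \<longleftrightarrow> children v \<noteq> {}"

end

theory Submission
  imports Defs
begin

text \<open>Fix one child \<open>(X\<^sub>0, Y\<^sub>0)\<close>. Then \<open>I\<close> is the set of positions at which \<open>X\<^sub>0\<close> and \<open>Y\<^sub>0\<close>
  differ, and \<open>(X, Y)\<close> is a child iff it agrees with \<open>(X\<^sub>0, Y\<^sub>0)\<close> outside \<open>I\<close> and has
  different digits on \<open>I\<close>. A child is therefore determined by the positions in \<open>I\<close> where \<open>X\<close> has
  the digit 1, and these may be any subset of \<open>I\<close>.\<close>

text \<open>Supplies the numbers with prescribed 1 bits from which \<open>card_children\<close>
  builds a child for each subset of positions.\<close>

lemma ex_nat_bits:
  fixes S :: "nat set"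
  assumes "finite S"
  shows "\<exists>N :: nat. \<forall>j. bit N j \<longleftrightarrow> j \<in> S"
  using assms
proof induction
  case (insert k S)
  then obtain N :: nat where "\<forall>j. bit N j \<longleftrightarrow> j \<in> S" by blast
  then have "\<forall>j. bit (set_bit k N) j \<longleftrightarrow> j \<in> insert k S"
    by (auto simp: bit_set_bit_iff)
  then show ?case by blast
qed (auto intro: exI[of _ 0])

lemma bit_nat_imp_less:
  fixes N :: nat
  assumes "N < 2 ^ k" and "bit N j"
  shows "j < k"
  using assms by (metis bit_take_bit_iff take_bit_nat_eq_self_iff)

text \<open>Doubling is injective, so equal \<open>CVT\<close> means equal AND. Equality of numbers
  is then tested bit by bit, and each position gives its own independent condition.\<close>

lemma children_iff:
  "(X, Y) \<in> children (CVT X0 Y0, XOR X0 Y0) \<longleftrightarrow>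
    (\<forall>j. (bit X j \<and> bit Y j \<longleftrightarrow> bit X0 j \<and> bit Y0 j) \<and>
         ((bit X j \<noteq> bit Y j) \<longleftrightarrow> (bit X0 j \<noteq> bit Y0 j)))"
proof -
  have "(X, Y) \<in> children (CVT X0 Y0, XOR X0 Y0) \<longleftrightarrow>
      Bit_Operations.and X Y = Bit_Operations.and X0 Y0 \<and>
      Bit_Operations.xor X Y = Bit_Operations.xor X0 Y0"
    unfolding children_def CVT_def XOR_def by simp
  also have "\<dots> \<longleftrightarrow>
    (\<forall>j. (bit X j \<and> bit Y j \<longleftrightarrow> bit X0 j \<and> bit Y0 j) \<and>
         ((bit X j \<noteq> bit Y j) \<longleftrightarrow> (bit X0 j \<noteq> bit Y0 j)))"
    unfolding bit_eq_iff[where 'a = nat] by (simp add: bit_and_iff bit_xor_iff all_conj_distrib)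
  finally show ?thesis .
qed

text \<open>AND and XOR together determine an unordered pair of bits: a pair of equal bits is
  forced, a pair of unequal bits may be swapped.\<close>

lemma children_eq_digits:
  assumes "I = {i. i \<ge> 1 \<and> digit X0 i \<noteq> digit Y0 i}"
  shows "children (CVT X0 Y0, XOR X0 Y0) =
    {(X, Y). (\<forall>i \<in> I. (digit X i, digit Y i) \<in> {(0, 1), (1, 0)}) \<and>
             (\<forall>i \<ge> 1. i \<notin> I \<longrightarrow> (digit X i, digit Y i) = (digit X0 i, digit Y0 i))}"
proof -
  have pos: "(bit X (i - 1) \<and> bit Y (i - 1) \<longleftrightarrow> bit X0 (i - 1) \<and> bit Y0 (i - 1)) \<and>
      ((bit X (i - 1) \<noteq> bit Y (i - 1)) \<longleftrightarrow> (bit X0 (i - 1) \<noteq> bit Y0 (i - 1))) \<longleftrightarrow>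
    (i \<in> I \<longrightarrow> (digit X i, digit Y i) \<in> {(0, 1), (1, 0)}) \<and>
      (i \<notin> I \<longrightarrow> (digit X i, digit Y i) = (digit X0 i, digit Y0 i))"
    if "i \<ge> 1" for X Y i
    using that unfolding assms digit_def
    by (cases "bit X (i - 1)"; cases "bit Y (i - 1)"; cases "bit X0 (i - 1)"; cases "bit Y0 (i - 1)")
      simp_all
  \<comment> \<open>Passes from bits numbered from 0 to digits numbered from 1.\<close>
  have shift: "(\<forall>j. R j) \<longleftrightarrow> (\<forall>i \<ge> 1. R (i - 1))" for R :: "nat \<Rightarrow> bool"
    by (metis Suc_eq_plus1 diff_Suc_1 le_add2)
  have "I \<subseteq> {1..}" using assms by auto
  then have "(X, Y) \<in> children (CVT X0 Y0, XOR X0 Y0) \<longleftrightarrow>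
      (\<forall>i \<in> I. (digit X i, digit Y i) \<in> {(0, 1), (1, 0)}) \<and>
      (\<forall>i \<ge> 1. i \<notin> I \<longrightarrow> (digit X i, digit Y i) = (digit X0 i, digit Y0 i))" for X Y
    unfolding children_iff by (subst shift) (use pos[of _ X Y] in blast)
  then show ?thesis
    by (simp only: set_eq_iff split_paired_All mem_Collect_eq prod.case) simp
qed

lemma card_children:
  assumes "finite I" and I: "I = {i. i \<ge> 1 \<and> digit X0 i \<noteq> digit Y0 i}"
  shows "card (children (CVT X0 Y0, XOR X0 Y0)) = 2 ^ card I"
proof -
  let ?C = "children (CVT X0 Y0, XOR X0 Y0)"
  let ?D = "{j. bit X0 j \<noteq> bit Y0 j}"
  \<comment> \<open>\<open>?D\<close> is \<open>I\<close> in the numbering from 0.\<close>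
  have D: "bij_betw Suc ?D I"
    unfolding I digit_def by (intro bij_betw_byWitness[where f' = "\<lambda>i. i - 1"]) auto
  then have fin: "finite ?D" and card_D: "card ?D = card I"
    using \<open>finite I\<close> bij_betw_finite bij_betw_same_card by blast+
  have "bij_betw (\<lambda>(X, Y). {j \<in> ?D. bit X j}) ?C (Pow ?D)"
  proof (intro bij_betw_imageI inj_onI)
    fix v w
    assume v: "v \<in> ?C" and w: "w \<in> ?C"
      and eq: "(case v of (X, Y) \<Rightarrow> {j \<in> ?D. bit X j}) = (case w of (X, Y) \<Rightarrow> {j \<in> ?D. bit X j})"
    obtain X Y X' Y' where vw: "v = (X, Y)" "w = (X', Y')" by fastforce
    have "bit X j = bit X' j \<and> bit Y j = bit Y' j" for j
    proof -
      \<comment> \<open>On \<open>?D\<close> the bit of \<open>Y\<close> is the complement of that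
        of \<open>X\<close>; elsewhere both children agree with \<open>(X0, Y0)\<close>.\<close>
      have "j \<in> ?D \<longrightarrow> bit X j = bit X' j" using eq unfolding vw by auto
      then show ?thesis using v w unfolding vw children_iff by blast
    qed
    then show "v = w" unfolding vw by (auto intro: bit_eqI)
  next
    show "(\<lambda>(X, Y). {j \<in> ?D. bit X j}) ` ?C = Pow ?D"
    proof (intro equalityI subsetI)
      fix S assume "S \<in> Pow ?D"
      then have S: "S \<subseteq> ?D" by simp
      obtain M :: nat where M: "\<forall>j. bit M j \<longleftrightarrow> j \<in> S"
        using ex_nat_bits[OF finite_subset[OF S fin]] by blast
      obtain N :: nat where N: "\<forall>j. bit N j \<longleftrightarrow> j \<in> ?D - S"
        using ex_nat_bits[OF finite_Diff[OF fin]] by blast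
      \<comment> \<open>\<open>?A\<close> carries the 1 bits common to \<open>X0\<close> and
        \<open>Y0\<close>, all outside \<open>?D\<close>; \<open>M\<close> and \<open>N\<close>
        split the positions of \<open>?D\<close> between the two coordinates.\<close>
      let ?A = "Bit_Operations.and X0 Y0"
      let ?X = "Bit_Operations.or ?A M" and ?Y = "Bit_Operations.or ?A N"
      have "(?X, ?Y) \<in> ?C"
        unfolding children_iff using M N S by (auto simp: bit_or_iff bit_and_iff)
      moreover have "S = {j \<in> ?D. bit ?X j}"
        using M S by (auto simp: bit_or_iff bit_and_iff)
      ultimately show "S \<in> (\<lambda>(X, Y). {j \<in> ?D. bit X j}) ` ?C"
        by (intro image_eqI[where x = "(?X, ?Y)"]) auto
    qed auto
  qed
  from bij_betw_same_card[OF this] show ?thesis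
    using fin card_D by (simp add: card_Pow)
qed

theorem theorem4:
  fixes P Q n m :: nat and I :: "nat set"
  assumes "P < 2 ^ (n + 1)" and "Q < 2 ^ (n + 1)"
    and "non_leaf (P, Q)"
    and "I = {i \<in> {1..n + 1}. digit P (i + 1) = 0 \<and> digit Q i = 1}"
    and "m = card I"
  shows "card (children (P, Q)) = 2 ^ m \<and>
    (\<exists>F :: nat \<Rightarrow> nat \<times> nat.
       children (P, Q) =
         {(X, Y).
            (\<forall>i \<in> I. (digit X i, digit Y i) \<in> {(0, 1), (1, 0)}) \<and>
            (\<forall>i \<ge> 1. i \<notin> I \<longrightarrow> (digit X i, digit Y i) = F i)})"
proof -
  obtain X0 Y0 where PQ: "P = CVT X0 Y0" "Q = XOR X0 Y0"
    using assms(3) unfolding non_leaf_def children_def by auto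
  have P: "bit P i \<longleftrightarrow> bit X0 (i - 1) \<and> bit Y0 (i - 1)" if "i \<ge> 1" for i
    using that unfolding PQ CVT_def by (auto simp: bit_double_iff bit_and_iff)
  have Q: "bit Q j \<longleftrightarrow> bit X0 j \<noteq> bit Y0 j" for j
    unfolding PQ XOR_def by (simp add: bit_xor_iff)
  \<comment> \<open>The bound on \<open>Q\<close> ensures that \<open>{1..n + 1}\<close> misses no
    position where \<open>Q\<close> has digit 1.\<close>
  have "i \<le> n + 1" if "bit Q (i - 1)" for i
    using bit_nat_imp_less[OF assms(2) that] by simp
  \<comment> \<open>Digit \<open>i + 1\<close> of \<open>P\<close> is the AND of the digits of
    \<open>X0\<close> and \<open>Y0\<close> at \<open>i\<close>, hence 0 wherever these
    differ.\<close>
  then have I: "I = {i. i \<ge> 1 \<and> digit X0 i \<noteq> digit Y0 i}"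
    unfolding assms(4) digit_def by (auto simp: P Q)
  have "finite I" using assms(4) by simp
  then show ?thesis
    using card_children[OF _ I] children_eq_digits[OF I] unfolding PQ assms(5)
    by (intro conjI exI[where x = "\<lambda>i. (digit X0 i, digit Y0 i)"]) simp_all
qed

end
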